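(* Let $(\gamma_t)_{t\ge 0}$ be the prudent walk on $\mathbb{Z}^2$. Then its asymptotic speed in the $L^1$-norm exists in probability and equals $3/7$: for every $\epsilon>0$, $$\lim_{t\to\infty}P\Bigl(\bigl|\tfrac1t\|\gamma_t\|_1-\tfrac37\bigr|>\epsilon\Bigr)=0.$$
   Context: $\vec e_1=(1,0)$, $\vec e_2=(0,1)$; $\|(x,y)\|_1=|x|+|y|$. The prudent walk $\gamma$ on $\mathbb{Z}^2$: $\gamma_0=(0,0)$; given $\gamma_{[0,t]}=\{\gamma_s\}_{0\le s\le t}$, a direction $\vec e\in\{\pm\vec e_1,\pm\vec e_2\}$ is called allowed if $\{\gamma_t+k\vec e: k\ge 1\}\cap\gamma_{[0,t]}=\varnothing$, and $\gamma_{t+1}=\gamma_t+\vec e$ with $\vec e$ chosen uniformly at random among the allowed directions. *)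

theory Defs
  imports "HOL-Probability.Probability"
begin

type_synonym site = "int \<times> int"

definition directions :: "site set" where
  "directions = {(1, 0), (-1, 0), (0, 1), (0, -1)}"

definition ray :: "site \<Rightarrow> site \<Rightarrow> site set" where
  "ray z e = {z + (k * fst e, k * snd e) | k :: int. k \<ge> 1}"

text \<open>Only the sites \<open>x 0, \<dots>, x t\<close> of the path \<open>x\<close> matter here. The set is nonempty for every
  history that the walk can produce: its last step can always be repeated.\<close>

definition allowed_directions :: "(nat \<Rightarrow> site) \<Rightarrow> nat \<Rightarrow> site set" where
  "allowed_directions x t = {e \<in> directions. ray (x t) e \<inter> x ` {0..t} = {}}"

definition l1_norm :: "site \<Rightarrow> real" where
  "l1_norm z = real_of_int (\<bar>fst z\<bar> + \<bar>snd z\<bar>)"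

text \<open>The locale characterises the law of the walk on an arbitrary probability space: given any
  history of positive probability, the next step is uniform on the allowed directions.
  No other step has positive probability, since the prescribed values already sum to one.\<close>

locale prudent_walk = prob_space M for M :: "'a measure" +
  fixes \<gamma> :: "nat \<Rightarrow> 'a \<Rightarrow> site"
  assumes measurable_walk: "\<And>t. \<gamma> t \<in> measurable M (count_space UNIV)"
    and start: "AE \<omega> in M. \<gamma> 0 \<omega> = (0, 0)"
    and step: "\<And>t x e. \<P>(\<omega> in M. \<forall>s\<le>t. \<gamma> s \<omega> = x s) > 0 \<Longrightarrow> e \<in> directions \<Longrightarrow>
      \<P>(\<omega> in M. \<gamma> (Suc t) \<omega> = \<gamma> t \<omega> + e \<bar> \<forall>s\<le>t. \<gamma> s \<omega> = x s) =
        (if e \<in> allowed_directions x t then 1 / real (card (allowed_directions x t)) else 0)"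

end

(* The walk always stands on the side of its bounding box that moved last. Just after the box has
   grown (a fresh side) it may go outward, left or right; while running along the side it may only
   keep running or go outward, each with probability 1/2. Away from the corners one growth takes
   7/3 steps on average, so the half-perimeter N_t of the box grows at speed 3/7.

   Three martingales with bounded increments make this rigorous: for each coordinate, the position
   plus the expected remainder of the current run, with the turns at corners ignored; and N_t plus a
   correction minus 3t/7, again ignoring turns. By Chebyshev's inequality for the stopped
   martingales all three stay below L = delta t up to time t with probability 1 - O(1/t). On that
   event everything is deterministic: between two growths in a coordinate the martingale is that
   coordinate, so the walk can cross from one corner to the opposite one along a side only while
   that side is shorter than about 2L. Hence it stays within O(L) of one corner whose opposite
   corner stays within O(L) of the origin, which gives N_t - |gamma_t| = O(L). The turns push the
   martingale away from the position like a local time, so there are only O(L) of them too. *)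
theory Submission
  imports Defs
begin

section \<open>The geometry of prudent paths\<close>

definition proj :: "site \<Rightarrow> site \<Rightarrow> int" where
  "proj e z = fst e * fst z + snd e * snd z"

text \<open>A path is the list of its steps, the latest step first.\<close>

abbreviation pos :: "site list \<Rightarrow> site" where
  "pos \<equiv> sum_list"

primrec visited :: "site list \<Rightarrow> site set" where
  "visited [] = {0}"
| "visited (e # h) = insert (pos (e # h)) (visited h)"

definition free :: "site list \<Rightarrow> site set" where
  "free h = {e \<in> directions. ray (pos h) e \<inter> visited h = {}}"

primrec legal :: "site list \<Rightarrow> bool" where
  "legal [] \<longleftrightarrow> True"
| "legal (e # h) \<longleftrightarrow> legal h \<and> e \<in> free h"

text \<open>\<open>reach u h\<close> is the maximum of \<open>proj u\<close> over the visited sites. The recursion exploits that a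
  step changes this maximum only if it is in direction \<open>u\<close>.\<close>

primrec reach :: "site \<Rightarrow> site list \<Rightarrow> int" where
  "reach u [] = 0"
| "reach u (e # h) = reach u h + (if e = u \<and> proj u (pos h) = reach u h then 1 else 0)"

definition grows :: "site \<Rightarrow> site list \<Rightarrow> bool" where
  "grows e h \<longleftrightarrow> proj e (pos h) = reach e h"

text \<open>\<open>front h\<close> is the outward normal of the side that moved last; the value on the empty path is junk.\<close>

primrec front :: "site list \<Rightarrow> site" where
  "front [] = 0"
| "front (e # h) = (if grows e h then e else front h)"

primrec fresh :: "site list \<Rightarrow> bool" where
  "fresh [] \<longleftrightarrow> True"
| "fresh (e # h) \<longleftrightarrow> grows e h"

lemma reach_Cons: "reach u (e # h) = reach u h + (if e = u \<and> grows u h then 1 else 0)"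
  by (simp add: grows_def)

declare reach.simps(2) [simp del] reach_Cons [simp]

section \<open>Directions, projections and the visited range\<close>

lemma directions_cases:
  assumes "e \<in> directions"
  obtains "e = (1, 0)" | "e = (-1, 0)" | "e = (0, 1)" | "e = (0, -1)"
  using assms by (auto simp: directions_def)

lemma finite_directions [simp]: "finite directions"
  by (simp add: directions_def)

lemma uminus_directions [simp]: "- e \<in> directions \<longleftrightarrow> e \<in> directions"
  by (cases e) (auto simp: directions_def)

lemma proj_add [simp]: "proj e (y + z) = proj e y + proj e z"
  by (simp add: proj_def algebra_simps)

lemma proj_uminus [simp]: "proj e (- z) = - proj e z"
  by (simp add: proj_def)

lemma proj_uminus_left [simp]: "proj (- e) z = - proj e z"
  by (simp add: proj_def)

lemma proj_zero [simp]: "proj e 0 = 0"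
  by (simp add: proj_def)

lemma proj_self [simp]: "e \<in> directions \<Longrightarrow> proj e e = 1"
  by (auto simp: directions_def proj_def)

lemma proj_scale [simp]: "proj e (k * fst z, k * snd z) = k * proj e z"
  by (simp add: proj_def algebra_simps)

lemma proj_le_1:
  assumes "e \<in> directions" "f \<in> directions"
  shows "\<bar>proj e f\<bar> \<le> 1" "e \<noteq> f \<Longrightarrow> proj e f \<le> 0"
    "e \<noteq> f \<Longrightarrow> e \<noteq> - f \<Longrightarrow> proj e f = 0"
  using assms by (auto simp: directions_def proj_def)

lemma proj_eq_0_same_axis:
  assumes "d \<in> directions" "e \<in> directions" "f \<in> directions" "proj d e = 0" "proj d f = 0"
  shows "f = e \<or> f = - e"
  using assms by (auto simp: directions_def proj_def)

lemma proj_commute: "proj e f = proj f e"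
  by (simp add: proj_def mult.commute)

lemma site_eqI:
  assumes "d \<in> directions" "e \<in> directions" "proj d e = 0"
    and "proj d y = proj d z" "proj e y = proj e z"
  shows "y = z"
  using assms by (cases y; cases z) (auto simp: directions_def proj_def)

lemma direction_perp:
  assumes "d \<in> directions"
  obtains e where "e \<in> directions" "proj d e = 0" "directions = {d, - d, e, - e}"
proof
  show "(- snd d, fst d) \<in> directions" "proj d (- snd d, fst d) = 0"
    using assms by (auto simp: directions_def proj_def)
  show "directions = {d, - d, (- snd d, fst d), - (- snd d, fst d)}"
    using assms by (auto simp: directions_def)
qed

lemma direction_ne_uminus: "e \<in> directions \<Longrightarrow> e \<noteq> - e"
  by (auto simp: directions_def)

lemma perp_ne:
  assumes "d \<in> directions" "proj d e = 0"
  shows "e \<noteq> d" "e \<noteq> - d" "d \<noteq> e" "d \<noteq> - e"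
  using assms by auto

lemma legal_directions: "legal h \<Longrightarrow> set h \<subseteq> directions"
  by (induction h) (auto simp: free_def)

lemma pos_visited: "pos h \<in> visited h"
  by (cases h) (auto simp: zero_prod_def)

lemma reach_nonneg: "reach u h \<ge> 0"
  by (induction h) auto

text \<open>A step in a direction other than \<open>u\<close> never raises \<open>proj u\<close>,
  and a step in direction \<open>u\<close> from below the maximum cannot exceed it; this justifies
  the recursion of \<open>reach\<close>.\<close>

lemma proj_le_reach:
  assumes "set h \<subseteq> directions" "u \<in> directions" "z \<in> visited h"
  shows "proj u z \<le> reach u h"
  using assms
proof (induction h arbitrary: z)
  case (Cons e h)
  have pos: "proj u (pos h) \<le> reach u h"
    using Cons pos_visited by auto
  have "proj u (pos (e # h)) \<le> reach u (e # h)"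
  proof (cases "e = u")
    case True
    then show ?thesis using pos Cons.prems by (auto simp: grows_def)
  next
    case False
    then show ?thesis using pos proj_le_1(2)[of u e] Cons.prems by auto
  qed
  moreover have "proj u z \<le> reach u (e # h)" if "z \<in> visited h"
    using Cons.IH[OF _ Cons.prems(2) that] Cons.prems(1) by simp
  ultimately show ?case using Cons.prems(3) unfolding visited.simps by blast
qed (simp add: zero_prod_def[symmetric])

text \<open>A discrete intermediate value argument: a level enters the range only when the walk
  steps onto it.\<close>

lemma visited_level:
  assumes "set h \<subseteq> directions" "u \<in> directions" "- reach (- u) h \<le> k" "k \<le> reach u h"
  shows "\<exists>z\<in>visited h. proj u z = k"
  using assms
proof (induction h)
  case (Cons e h)
  have *: "proj u (pos h) \<le> reach u h" "proj (- u) (pos h) \<le> reach (- u) h"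
    using Cons.prems by (auto intro!: proj_le_reach pos_visited simp del: proj_uminus_left)
  show ?case
  proof (cases "- reach (- u) h \<le> k \<and> k \<le> reach u h")
    case True
    then show ?thesis using Cons by auto
  next
    case False
    then have "k = proj u (pos (e # h))"
      using Cons.prems * direction_ne_uminus[of u] by (auto simp: grows_def split: if_splits)
    then show ?thesis by auto
  qed
qed (simp add: zero_prod_def[symmetric])

text \<open>The conjunct about \<open>z\<close> with \<open>proj e z = k\<close> says that every line orthogonal to the front that meets
  the box contains a visited site strictly behind the front, so the inward step is never allowed.\<close>

definition on_front :: "site list \<Rightarrow> bool" where
  "on_front h \<longleftrightarrow> front h \<in> directions \<and> grows (front h) h \<and>
    (\<forall>e\<in>directions. proj (front h) e = 0 \<longrightarrow>
      (\<forall>k\<in>{- reach (- e) h..reach e h}. \<exists>z\<in>visited h. proj e z = k \<and> proj (front h) z < reach (front h) h)) \<and>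
    (fresh h \<longrightarrow> hd h = front h \<and> (\<forall>z\<in>visited h. proj (front h) z = reach (front h) h \<longrightarrow> z = pos h)) \<and>
    (\<not> fresh h \<longrightarrow> hd h \<in> directions \<and> proj (front h) (hd h) = 0 \<and>
       (\<forall>z\<in>visited h. proj (front h) z = reach (front h) h \<longrightarrow> proj (hd h) z \<le> proj (hd h) (pos h)))"

text \<open>The outward ray leaves the box and the inward ray meets a visited site. Along the side
  both rays are free from a fresh site, while a run has its own trail behind it.\<close>

lemma free_on_front:
  assumes "set h \<subseteq> directions" "h \<noteq> []" "on_front h"
  shows "free h = (if fresh h then directions - {- front h} else {front h, hd h})"
proof -
  define d where "d = front h"
  have d: "d \<in> directions" "proj d (pos h) = reach d h"
    using assms by (auto simp: on_front_def d_def grows_def)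
  have out: "d \<in> free h"
    using d proj_le_reach[OF assms(1), of d] by (fastforce simp: free_def ray_def)
  obtain e where e: "e \<in> directions" "proj d e = 0" "directions = {d, - d, e, - e}"
    using direction_perp d by metis
  have "- d \<notin> free h"
  proof -
    have "- reach (- e) h \<le> proj e (pos h)" "proj e (pos h) \<le> reach e h"
      using proj_le_reach[OF assms(1) _ pos_visited, of e] proj_le_reach[OF assms(1) _ pos_visited, of "- e"] e
      by auto
    then obtain z where z: "z \<in> visited h" "proj e z = proj e (pos h)" "proj d z < reach d h"
      using assms(3) e(1,2) unfolding on_front_def d_def[symmetric] by (meson atLeastAtMost_iff)
    \<comment> \<open>\<open>z\<close> shares the coordinate along \<open>e\<close> with the current
      position, so it is the \<open>k\<close>-th site of the inward ray.\<close>
    define k where "k = reach d h - proj d z"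
    have "z = pos h + (k * fst (- d), k * snd (- d))"
      by (rule site_eqI[OF d(1) e(1,2)])
        (use d e z in \<open>simp_all only: proj_add proj_scale, simp_all add: k_def proj_commute[of e d]\<close>)
    then have "z \<in> ray (pos h) (- d)"
      using z(3) by (auto simp: ray_def k_def)
    then show ?thesis using z(1) by (auto simp: free_def)
  qed
  show ?thesis
  proof (cases "fresh h")
    case True
    have uniq: "z = pos h" if "z \<in> visited h" "proj d z = reach d h" for z
      using assms(3) True that by (simp add: on_front_def d_def)
    have "f \<in> free h" if f: "f \<in> directions" "proj d f = 0" for f
    proof -
      have "pos h + (k * fst f, k * snd f) \<notin> visited h" if "k \<ge> 1" for k
      proof
        assume v: "pos h + (k * fst f, k * snd f) \<in> visited h"
        have "proj f (pos h + (k * fst f, k * snd f)) = proj f (pos h)"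
          using uniq[OF v] f d by simp
        then show False using f that by simp
      qed
      then show ?thesis using f by (auto simp: free_def ray_def)
    qed
    then have "e \<in> free h" "- e \<in> free h" using e by auto
    moreover have "free h \<subseteq> directions" by (auto simp: free_def)
    moreover have "directions - {- d} \<subseteq> free h"
      using out calculation(1,2) unfolding e(3) by blast
    ultimately have "free h = directions - {- d}" using \<open>- d \<notin> free h\<close> by (intro equalityI; blast)
    then show ?thesis using True by (simp add: d_def)
  next
    case False
    define r where "r = hd h"
    have r: "r \<in> directions" "proj d r = 0"
      "\<And>z. z \<in> visited h \<Longrightarrow> proj d z = reach d h \<Longrightarrow> proj r z \<le> proj r (pos h)"
      using assms(3) False unfolding on_front_def d_def r_def by blast+
    have "r \<in> free h"
    proof -
      have "pos h + (k * fst r, k * snd r) \<notin> visited h" if "k \<ge> 1" for k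
      proof
        assume v: "pos h + (k * fst r, k * snd r) \<in> visited h"
        have "proj d (pos h + (k * fst r, k * snd r)) = reach d h"
          using r(2) d by simp
        from r(3)[OF v this] have "k * proj r r \<le> 0" by simp
        then show False using r that by simp
      qed
      then show ?thesis using r by (auto simp: free_def ray_def)
    qed
    moreover have "- r \<notin> free h"
    proof -
      have "pos h = r + pos (tl h)" "pos (tl h) \<in> visited h"
        using assms(2) pos_visited by (cases h; simp add: r_def)+
      then have "pos (tl h) = pos h + (1 * fst (- r), 1 * snd (- r))"
        by (cases r) (simp add: prod_eq_iff)
      then have "pos (tl h) \<in> ray (pos h) (- r)" by (force simp: ray_def)
      then show ?thesis using \<open>pos (tl h) \<in> visited h\<close> by (auto simp: free_def)
    qed
    moreover have dirs: "directions = {d, - d, r, - r}"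
      using e r proj_eq_0_same_axis[OF d(1) e(1) r(1)] by auto
    moreover have "free h \<subseteq> directions" by (auto simp: free_def)
    ultimately have "free h \<subseteq> {d, r}" using \<open>- d \<notin> free h\<close> unfolding dirs by blast
    then have "free h = {d, r}" using out \<open>r \<in> free h\<close> by (intro equalityI) simp_all
    then show ?thesis using False by (simp add: d_def r_def)
  qed
qed

text \<open>All earlier sites now lie strictly behind the new front, so \<open>visited_level\<close>
  supplies the blocking sites.\<close>

lemma on_front_Cons_grows:
  assumes "set h \<subseteq> directions" "e \<in> directions" "grows e h"
  shows "on_front (e # h)"
proof -
  have le: "proj e z \<le> reach e h" if "z \<in> visited h" for z
    using proj_le_reach assms that by blast
  have slices: "\<exists>z\<in>visited (e # h). proj f z = k \<and> proj e z < reach e (e # h)"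
    if f: "f \<in> directions" "proj e f = 0" "- reach (- f) (e # h) \<le> k" "k \<le> reach f (e # h)" for f k
  proof -
    have unch: "reach f (e # h) = reach f h" "reach (- f) (e # h) = reach (- f) h"
      using perp_ne[OF assms(2), of f] that by auto
    obtain z where "z \<in> visited h" "proj f z = k"
      using visited_level[OF assms(1) f(1), of k] f(3,4) unfolding unch by blast
    then show ?thesis using le[of z] assms by auto
  qed
  have st: "front (e # h) = e" "fresh (e # h)" "hd (e # h) = e" using assms by simp_all
  have "grows e (e # h)" using assms by (simp add: grows_def)
  moreover have "z = pos (e # h)" if "z \<in> visited (e # h)" "proj e z = reach e (e # h)" for z
    using that le[of z] assms(3) by (cases "z = pos (e # h)") simp_all
  moreover have "\<forall>f\<in>directions. proj e f = 0 \<longrightarrow> (\<forall>k\<in>{- reach (- f) (e # h)..reach f (e # h)}.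
      \<exists>z\<in>visited (e # h). proj f z = k \<and> proj e z < reach e (e # h))"
    by (intro ballI impI slices) (simp_all only: atLeastAtMost_iff)
  ultimately show ?thesis
    using assms(2) st(2) unfolding on_front_def st(1,3) by blast
qed

lemma on_front_Cons_not_grows:
  assumes "on_front h" "h \<noteq> []" "set h \<subseteq> directions" "e \<in> free h" "\<not> grows e h"
  shows "on_front (e # h)"
proof -
  define d where "d = front h"
  have d: "d \<in> directions" "proj d (pos h) = reach d h"
    using assms by (auto simp: on_front_def d_def grows_def)
  have e: "e \<in> directions" "e \<noteq> d" using assms d by (auto simp: free_def grows_def)
  have "e \<noteq> - d"
    using assms free_on_front[OF assms(3,2,1)] direction_ne_uminus[OF d(1)] d(1) perp_ne(2)[OF d(1), of e]
    by (auto simp: d_def on_front_def split: if_splits)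
  then have de: "proj d e = 0" using proj_le_1(3)[OF d(1) e(1)] e by (metis minus_minus)
  have same: "reach f (e # h) = reach f h" for f using assms by auto
  \<comment> \<open>Either the front was fresh and its line holds only the current position, or
    \<open>e\<close> repeats the last step.\<close>
  have line: "proj e z \<le> proj e (pos h)" if "z \<in> visited h" "proj d z = reach d h" for z
    using that assms(1) free_on_front[OF assms(3,2,1)] assms(4) e(2)
    by (auto simp: on_front_def d_def split: if_splits)
  have st: "front (e # h) = d" "\<not> fresh (e # h)" "hd (e # h) = e" using assms by (simp_all add: d_def)
  have "grows d (e # h)" using d de by (simp only: grows_def same) simp
  moreover have "proj e z \<le> proj e (pos (e # h))" if "z \<in> visited (e # h)" "proj d z = reach d h" for z
    using that line[of z] e(1) by (cases "z = pos (e # h)") simp_all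
  moreover have "\<forall>f\<in>directions. proj d f = 0 \<longrightarrow> (\<forall>k\<in>{- reach (- f) h..reach f h}.
      \<exists>z\<in>visited (e # h). proj f z = k \<and> proj d z < reach d h)"
    using assms(1) unfolding on_front_def d_def[symmetric] visited.simps by blast
  ultimately show ?thesis
    using d(1) e(1) de st(2) unfolding on_front_def st(1,3) same by blast
qed

lemma legal_on_front:
  assumes "legal h" "h \<noteq> []"
  shows "on_front h"
  using assms
proof (induction h)
  case (Cons e h)
  have e: "e \<in> directions" "set h \<subseteq> directions" using Cons.prems legal_directions by fastforce+
  show ?case
  proof (cases "grows e h")
    case True
    then show ?thesis using on_front_Cons_grows e by blast
  next
    case False
    then have "h \<noteq> []" by (auto simp: grows_def)
    then show ?thesis using on_front_Cons_not_grows False Cons e by auto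
  qed
qed simp

text \<open>There are four, three or two equally likely steps; the distinctness facts let sums over
  \<open>free h\<close> be evaluated termwise.\<close>

lemma free_cases:
  assumes "legal h"
  obtains (start) "h = []" "free h = directions" 
  | (fresh) d e where "h \<noteq> []" "fresh h" "front h = d" "hd h = d" "d \<in> directions" "e \<in> directions"
      "proj d e = 0" "free h = {d, e, - e}" "d \<noteq> e" "d \<noteq> - e" "e \<noteq> - e"
  | (run) d e where "h \<noteq> []" "\<not> fresh h" "front h = d" "hd h = e" "d \<in> directions" "e \<in> directions"
      "proj d e = 0" "free h = {d, e}" "d \<noteq> e" "d \<noteq> - e"
proof (cases "h = []")
  case True
  have "0 \<notin> ray 0 e" if "e \<in> directions" for e
  proof
    assume "0 \<in> ray 0 e"
    then obtain k where "k \<ge> 1" "0 = (k * fst e, k * snd e)" unfolding ray_def add_0 by blast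
    then show False using proj_scale[of e k e] that by simp
  qed
  then have "free h = directions" using True by (auto simp: free_def)
  then show ?thesis using True start by blast
next
  case False
  note h = False legal_on_front[OF assms False] free_on_front[OF legal_directions[OF assms] False]
  define d where "d = front h"
  have d: "d \<in> directions" using h by (auto simp: on_front_def d_def)
  show ?thesis
  proof (cases "fresh h")
    case True
    obtain e where e: "e \<in> directions" "proj d e = 0" "directions = {d, - d, e, - e}"
      using direction_perp d by metis
    have ne: "d \<noteq> e" "d \<noteq> - e" "e \<noteq> - e" using d e direction_ne_uminus by auto
    have "free h = directions - {- d}" using True h(3)[OF h(2)] by (simp add: d_def)
    also have "\<dots> = {d, e, - e}"
    proof -
      have "d \<noteq> - d" "e \<noteq> - d" using ne direction_ne_uminus[OF d] minus_equation_iff[of d e] by metis+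
      then show ?thesis using ne(1) unfolding e(3) by (simp add: insert_Diff_if)
    qed
    finally have "free h = {d, e, - e}" .
    moreover have "hd h = d" using True h(2) unfolding on_front_def d_def by blast
    moreover have "front h = d" by (simp add: d_def)
    ultimately show ?thesis by (intro fresh[of d e] True h(1) d e(1,2) ne)
  next
    case False
    have r: "hd h \<in> directions" "proj d (hd h) = 0"
      using False h(2) unfolding d_def on_front_def by blast+
    have "free h = {d, hd h}" using False h(3)[OF h(2)] by (simp add: d_def)
    then show ?thesis by (intro run[of d "hd h"] False h(1) d r perp_ne(3,4)[OF d r(2)] d_def[symmetric] refl)
  qed
qed


text \<open>A step along the side may still grow the box; this happens exactly at a corner.\<close>

lemma legal_Cons_cases:
  assumes "legal (x # h)"
  obtains (start) "h = []" "grows x h"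
  | (front) "h \<noteq> []" "x = front h" "grows x h"
  | (side) "h \<noteq> []" "x \<noteq> front h" "fresh h \<or> x = hd h"
proof -
  have h: "legal h" "x \<in> free h" using assms by auto
  show ?thesis
  proof (cases "h = []")
    case True
    then show ?thesis using start by (simp add: grows_def)
  next
    case False
    note J = legal_on_front[OF h(1) False]
    show ?thesis
    proof (cases "x = front h")
      case True
      then show ?thesis using front False J unfolding on_front_def by blast
    next
      case ne: False
      have "fresh h \<or> x = hd h"
        using free_on_front[OF legal_directions[OF h(1)] False J] h(2) ne by (simp split: if_splits)
      then show ?thesis using side False ne by blast
    qed
  qed
qed

section \<open>Martingales along the path\<close>

text \<open>A growth through a corner, where a step along the old side opens a new one. The first
  step has no old side and is excluded.\<close>

definition turn :: "site \<Rightarrow> site list \<Rightarrow> bool" where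
  "turn e h \<longleftrightarrow> h \<noteq> [] \<and> grows e h \<and> e \<noteq> front h"

primrec turns :: "site \<Rightarrow> site list \<Rightarrow> int" where
  "turns u [] = 0"
| "turns u (e # h) = turns u h + (if e = u \<and> turn e h then 1 else 0)"

text \<open>The expected further displacement of the current run in direction \<open>u\<close>,
  corners ignored: the mean remaining length is 1/2 + 1/4 + ... = 1, and at a fresh site the two
  senses cancel.\<close>

definition run :: "site \<Rightarrow> site list \<Rightarrow> int" where
  "run u h = (if fresh h then 0 else proj u (hd h))"

text \<open>A run started at a fresh site has unrestricted length with mean 2 when it starts, and further
  expected length 1 at each later moment. Thus \<open>shift u\<close> is the increment of
  \<open>proj u (pos h) + run u h\<close>, except that a growth at a corner counts as if the run went on.\<close>

definition shift :: "site \<Rightarrow> site list \<Rightarrow> site \<Rightarrow> real" where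
  "shift u h e = (if h = [] then 0 else if e = front h then - real_of_int (run u h)
     else if fresh h then 2 * real_of_int (proj u e) else real_of_int (proj u e))"

text \<open>The increment of \<open>N - 3 t / 7 + (if fresh h then 0 else 1 / 7)\<close>, where \<open>N\<close> is the half-perimeter,
  with the same convention at corners. The rate \<open>v = 3 / 7\<close> and the correction \<open>c = 1 / 7\<close> solve
  \<open>1 / 3 + 2 / 3 * c = v\<close> and \<open>1 / 2 + 1 / 2 * c = v + c\<close>.\<close>

definition clock :: "site list \<Rightarrow> site \<Rightarrow> real" where
  "clock h e = (if h = [] then 0 else if e = front h then (if fresh h then 4 / 7 else 3 / 7)
     else if fresh h then - 2 / 7 else - 3 / 7)"

primrec total :: "(site list \<Rightarrow> site \<Rightarrow> real) \<Rightarrow> site list \<Rightarrow> real" where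
  "total inc [] = 0"
| "total inc (e # h) = total inc h + inc h e"

lemma shift_uminus: "shift (- u) h e = - shift u h e"
  by (simp add: shift_def run_def)

lemma total_shift_uminus: "total (shift (- u)) h = - total (shift u) h"
  by (induction h) (simp_all add: shift_uminus)

lemma run_uminus: "run (- u) h = - run u h"
  by (simp add: run_def)

text \<open>The allowed directions are equally likely, so a zero sum is the martingale property. For
  \<open>clock\<close> the sums are 4/7 - 2/7 - 2/7 and 3/7 - 3/7.\<close>

lemma shift_clock_sum:
  assumes "legal h"
  shows "(\<Sum>e\<in>free h. shift u h e) = 0" "(\<Sum>e\<in>free h. clock h e) = 0"
  using assms by (cases rule: free_cases; simp add: shift_def clock_def run_def)+

lemma run_bound:
  assumes "legal h" "u \<in> directions"
  shows "\<bar>run u h\<bar> \<le> 1"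
  using assms(1)
  by (cases rule: free_cases) (use assms(2) proj_le_1(1) in \<open>auto simp: run_def\<close>)

lemma shift_bound:
  assumes "legal h" "u \<in> directions" "e \<in> free h"
  shows "\<bar>shift u h e\<bar> \<le> 2"
proof -
  have "\<bar>run u h\<bar> \<le> 1" "\<bar>proj u e\<bar> \<le> 1"
    using run_bound[OF assms(1,2)] assms proj_le_1(1)[of u e] by (auto simp: free_def)
  then show ?thesis by (auto simp: shift_def abs_le_iff)
qed

lemma clock_bound: "\<bar>clock h e\<bar> \<le> 2"
  by (simp add: clock_def)

section \<open>Counting growths and turns\<close>

lemma proj_direction:
  assumes "u \<in> directions" "x \<in> directions"
  shows "proj u x = of_bool (x = u) - of_bool (x = - u)"
  by (cases rule: directions_cases[OF assms(1)]; cases rule: directions_cases[OF assms(2)])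
    (simp_all add: proj_def)

lemma signed_count:
  assumes "u \<in> directions" "x \<in> directions"
  shows "(if x = u \<and> P u then 1 else 0) - (if x = - u \<and> P (- u) then 1 else 0) = (if P x then proj u x else 0)"
proof -
  consider "x = u" | "x = - u" | "x \<noteq> u" "x \<noteq> - u" by blast
  then show ?thesis
  proof cases
    case 2
    have "- u \<noteq> u" using direction_ne_uminus[OF assms(1)] by (rule not_sym)
    then show ?thesis unfolding 2 using assms(1) by simp
  next
    case 1
    then show ?thesis using direction_ne_uminus[OF assms(1)] assms(1) by simp
  next
    case 3
    then show ?thesis using proj_direction[OF assms] by simp
  qed
qed

lemma reach_diff_Cons:
  assumes "u \<in> directions" "x \<in> directions"
  shows "reach u (x # h) - reach (- u) (x # h) =
    reach u h - reach (- u) h + (if grows x h then proj u x else 0)"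
  using signed_count[OF assms, of "\<lambda>e. grows e h"] unfolding reach_Cons by linarith

lemma turns_diff_Cons:
  assumes "u \<in> directions" "x \<in> directions"
  shows "turns u (x # h) - turns (- u) (x # h) =
    turns u h - turns (- u) h + (if turn x h then proj u x else 0)"
proof -
  have "(if x = u \<and> turn x h then 1 else 0::int) - (if x = - u \<and> turn x h then 1 else 0) =
      (if turn x h then proj u x else 0)"
    using signed_count[OF assms, of "\<lambda>_. turn x h"] .
  then show ?thesis unfolding turns.simps by linarith
qed

text \<open>On a side step without growth everything cancels. On a turn the remainder of the run is
  lost as well, which changes the gain \<open>proj u x\<close> into \<open>- proj u x\<close>; hence
  the coefficient 2.\<close>

lemma shift_Cons:
  assumes "legal (x # h)" "u \<in> directions"
  shows "proj u x + run u (x # h) - run u h - shift u h x =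
    (if grows x h then proj u x else 0) - 2 * (if turn x h then proj u x else 0)"
  using assms(1)
proof (cases rule: legal_Cons_cases)
  case side
  then show ?thesis by (cases "fresh h") (simp_all add: shift_def run_def turn_def)
qed (simp_all add: shift_def run_def turn_def)

lemma total_shift:
  assumes "legal h" "u \<in> directions"
  shows "proj u (pos h) + run u h - total (shift u) h =
    reach u h - reach (- u) h - 2 * (turns u h - turns (- u) h)"
  using assms(1)
proof (induction h)
  case (Cons x h)
  then have x: "legal h" "x \<in> directions" by (auto simp: free_def)
  show ?case
    using Cons.IH[OF x(1)] shift_Cons[OF Cons.prems assms(2)]
      reach_diff_Cons[OF assms(2) x(2), of h] turns_diff_Cons[OF assms(2) x(2), of h]
    by (simp del: reach_Cons turns.simps split del: if_split)
qed (simp add: run_def)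

text \<open>The sum of \<open>reach\<close> over the four directions is the half-perimeter of the
  bounding box.\<close>

lemma sum_reach_Cons:
  assumes "x \<in> directions"
  shows "(\<Sum>u\<in>directions. reach u (x # h)) = (\<Sum>u\<in>directions. reach u h) + (if grows x h then 1 else 0)"
    "(\<Sum>u\<in>directions. turns u (x # h)) = (\<Sum>u\<in>directions. turns u h) + (if turn x h then 1 else 0)"
proof -
  have "(\<Sum>u\<in>directions. if x = u \<and> P u then 1 else 0) = (if P x then 1 else 0 :: int)" for P
  proof -
    have "(\<Sum>u\<in>directions. if x = u \<and> P u then 1 else 0) =
        (\<Sum>u\<in>directions. if x = u then if P x then 1 else 0 else 0 :: int)"
      by (intro sum.cong) simp_all
    then show ?thesis using assms by simp
  qed
  from this[of "\<lambda>u. grows u h"] this[of "\<lambda>u. turn x h"]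
  show "(\<Sum>u\<in>directions. reach u (x # h)) = (\<Sum>u\<in>directions. reach u h) + (if grows x h then 1 else 0)"
    "(\<Sum>u\<in>directions. turns u (x # h)) = (\<Sum>u\<in>directions. turns u h) + (if turn x h then 1 else 0)"
    by (simp_all add: sum.distrib)
qed

text \<open>The 4/7 is 1 - 3/7 for the first step, which always grows. A turn exceeds the side step
  assumed by \<open>clock\<close> by 1 - 1/7 = 6/7: one growth, minus the correction for being in a
  run.\<close>

lemma total_clock:
  assumes "legal h"
  shows "(\<Sum>u\<in>directions. reach u h) = 3 / 7 * length h + (if h = [] then 0 else 4 / 7) + total clock h
    + 6 / 7 * (\<Sum>u\<in>directions. turns u h) - (if fresh h then 0 else 1 / 7)"
  using assms
proof (induction h)
  case (Cons x h)
  then have x: "legal h" "x \<in> directions" by (auto simp: free_def)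
  define N N' T T' where "N = real_of_int (\<Sum>u\<in>directions. reach u h)"
    and "N' = real_of_int (\<Sum>u\<in>directions. reach u (x # h))"
    and "T = real_of_int (\<Sum>u\<in>directions. turns u h)"
    and "T' = real_of_int (\<Sum>u\<in>directions. turns u (x # h))"
  have N: "N' = N + (if grows x h then 1 else 0)" "T' = T + (if turn x h then 1 else 0)"
    using sum_reach_Cons[OF x(2), of h] by (simp_all add: N_def N'_def T_def T'_def del: reach_Cons turns.simps)
  have IH: "N = 3 / 7 * length h + (if h = [] then 0 else 4 / 7) + total clock h
      + 6 / 7 * T - (if fresh h then 0 else 1 / 7)"
    using Cons.IH[OF x(1)] by (simp add: N_def T_def)
  have "N' = 3 / 7 * length (x # h) + 4 / 7 + total clock (x # h) + 6 / 7 * T' - (if grows x h then 0 else 1 / 7)"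
    using Cons.prems
  proof (cases rule: legal_Cons_cases)
    case side
    then show ?thesis using N IH
      by (cases "fresh h"; cases "grows x h") (simp_all add: clock_def turn_def field_simps)
  next
    case front
    then show ?thesis using N IH by (cases "fresh h") (simp_all add: clock_def turn_def field_simps)
  qed (use N IH in \<open>simp add: clock_def turn_def\<close>)
  then show ?case by (simp add: N'_def T'_def del: reach_Cons turns.simps)
qed simp

section \<open>Deterministic consequences of confinement\<close>

primrec confined :: "(site list \<Rightarrow> site \<Rightarrow> real) \<Rightarrow> real \<Rightarrow> site list \<Rightarrow> bool" where
  "confined inc L [] \<longleftrightarrow> True"
| "confined inc L (e # h) \<longleftrightarrow> confined inc L h \<and> \<bar>total inc (e # h)\<bar> \<le> L"

lemma confined_total: "confined inc L h \<Longrightarrow> L \<ge> 0 \<Longrightarrow> \<bar>total inc h\<bar> \<le> L"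
  by (cases h) auto

text \<open>The first quantity changes only when the box grows in direction \<open>u\<close> or \<open>- u\<close>; after a growth in
  direction \<open>u\<close> it equals \<open>total (shift u) h\<close>.\<close>

definition near_corner :: "site \<Rightarrow> real \<Rightarrow> site list \<Rightarrow> bool" where
  "near_corner u L h \<longleftrightarrow> \<bar>reach u h - proj u (pos h) - run u h + total (shift u) h\<bar> \<le> L
     \<and> real_of_int (reach (- u) h) \<le> 2 * L + 2"

text \<open>After the growth the first quantity is the martingale itself. If the walk comes from the
  side \<open>- u\<close>, the bound there with \<open>reach u h \<ge> 0\<close> and
  \<open>run u h \<ge> - 1\<close> gives \<open>reach (- u) h \<le> 2 * L + 1\<close>: a crossing
  succeeds only while the side is short.\<close>

lemma near_corner_grows:
  assumes "legal (u # h)" "grows u h" "near_corner u L h \<or> near_corner (- u) L h"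
    and "\<bar>total (shift u) h\<bar> \<le> L" "\<bar>total (shift u) (u # h)\<bar> \<le> L"
  shows "near_corner u L (u # h)"
proof -
  have u: "u \<in> directions" "legal h" using assms(1) by (auto simp: free_def)
  have at: "proj u (pos h) = reach u h" using assms(2) by (simp add: grows_def)
  have "real_of_int (reach (- u) h) \<le> 2 * L + 2"
    using assms(3)
  proof
    assume "near_corner (- u) L h"
    then have "reach (- u) h + proj u (pos h) + run u h - total (shift u) h \<le> L"
      by (auto simp: near_corner_def run_uminus total_shift_uminus abs_le_iff)
    moreover have "- 1 \<le> run u h" "0 \<le> proj u (pos h)"
      using run_bound[OF u(2,1)] reach_nonneg[of u h] at by auto
    ultimately show ?thesis using assms(4) by linarith
  qed (simp add: near_corner_def)
  then show ?thesis
    using assms(2,5) u at direction_ne_uminus[OF u(1)] by (simp add: near_corner_def run_def)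
qed

text \<open>The right-hand side of \<open>shift_Cons\<close> vanishes and the two reaches stay put,
  so both quantities are unchanged.\<close>

lemma near_corner_other:
  assumes "legal (x # h)" "u \<in> directions" "\<not> (grows x h \<and> (x = u \<or> x = - u))" "near_corner u L h"
  shows "near_corner u L (x # h)"
proof -
  have x: "x \<in> directions" using assms(1) by (auto simp: free_def)
  have "(if grows x h then proj u x else 0) = 0"
    using proj_direction[OF assms(2) x] assms(3) by simp
  moreover have "(if turn x h then proj u x else 0) = 0"
    using proj_direction[OF assms(2) x] assms(3) by (simp add: turn_def)
  moreover have "reach u (x # h) = reach u h" "reach (- u) (x # h) = reach (- u) h"
    using assms(3) by auto
  ultimately have eq: "real_of_int (reach u (x # h) - proj u (pos (x # h)) - run u (x # h)) + total (shift u) (x # h)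
      = real_of_int (reach u h - proj u (pos h) - run u h) + total (shift u) h"
    "reach (- u) (x # h) = reach (- u) h"
    using shift_Cons[OF assms(1,2)] by (simp_all del: reach_Cons split del: if_split)
  show ?thesis using assms(4) unfolding near_corner_def eq .
qed

text \<open>At the start both alternatives hold; later a growth in direction \<open>u\<close> or
  \<open>- u\<close> establishes the corresponding one, and other steps preserve each.\<close>

lemma confined_near_corner:
  assumes "legal h" "u \<in> directions" "L \<ge> 0" "confined (shift u) L h"
  shows "near_corner u L h \<or> near_corner (- u) L h"
  using assms(1,4)
proof (induction h)
  case Nil
  then show ?case using assms(3) by (simp add: near_corner_def run_def)
next
  case (Cons x h)
  then have IH: "near_corner u L h \<or> near_corner (- u) L h" by simp
  have L: "\<bar>total (shift u) h\<bar> \<le> L" "\<bar>total (shift u) (x # h)\<bar> \<le> L"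
    using Cons.prems confined_total assms(3) by (auto simp del: total.simps)
  consider (pos) "grows x h" "x = u" | (neg) "grows x h" "x = - u"
    | (other) "\<not> (grows x h \<and> (x = u \<or> x = - u))" by blast
  then show ?case
  proof cases
    case pos
    then show ?thesis using near_corner_grows[of u h L] Cons.prems IH L by simp
  next
    case neg
    then have "near_corner (- u) L (- u # h)"
      using near_corner_grows[of "- u" h L] Cons.prems IH L
      by (simp only: minus_minus total_shift_uminus abs_minus_cancel) blast
    then show ?thesis using neg by simp
  next
    case other
    then show ?thesis
      using near_corner_other[OF Cons.prems(1) assms(2)] near_corner_other[OF Cons.prems(1), of "- u"]
        IH assms(2) by auto
  qed
qed

lemma turns_bounds: "0 \<le> turns u h" "turns u h \<le> reach u h"
  by (induction h) (auto simp: turn_def)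

text \<open>The first bound adds L + 1 + L from the first quantity to 2 L + 2 for the opposite
  reach. For the second, turns towards \<open>- u\<close> number at most
  \<open>reach (- u) h\<close>, and \<open>total_shift\<close> then limits those towards
  \<open>u\<close>.\<close>

lemma near_corner_bounds:
  fixes L :: real
  assumes "legal h" "u \<in> directions" "near_corner u L h" "\<bar>total (shift u) h\<bar> \<le> L"
  shows "reach u h + reach (- u) h - \<bar>proj u (pos h)\<bar> \<le> 4 * L + 3"
    and "turns u h + turns (- u) h \<le> 5 * L + 4"
proof -
  define p r a b S where "p = real_of_int (proj u (pos h))" and "r = real_of_int (run u h)"
    and "a = real_of_int (reach u h)" and "b = real_of_int (reach (- u) h)" and "S = total (shift u) h"
  define t v where "t = real_of_int (turns u h)" and "v = real_of_int (turns (- u) h)"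
  have facts: "\<bar>a - p - r + S\<bar> \<le> L" "b \<le> 2 * L + 2" "\<bar>S\<bar> \<le> L" "0 \<le> b" "\<bar>r\<bar> \<le> 1" "v \<le> b"
    "p + r - S = a - b - 2 * (t - v)"
    using assms(3,4) total_shift[OF assms(1,2)] run_bound[OF assms(1,2)] turns_bounds(2)[of "- u" h]
      reach_nonneg[of "- u" h]
    unfolding near_corner_def p_def r_def a_def b_def S_def t_def v_def by (simp_all flip: of_int_abs)
  have "a + b - \<bar>p\<bar> \<le> 4 * L + 3" using facts by linarith
  then show "reach u h + reach (- u) h - \<bar>proj u (pos h)\<bar> \<le> 4 * L + 3"
    by (simp add: p_def a_def b_def)
  have "a - p - r + S \<le> L" "0 \<le> L" using facts(1,3) by linarith+
  moreover have "2 * t = a - p - r + S - b + 2 * v" using facts(7) by simp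
  ultimately have "2 * t \<le> L - b + 2 * v" by simp
  then have "t + v \<le> 5 * L + 4" using facts(2,4,6) \<open>0 \<le> L\<close> by linarith
  then show "turns u h + turns (- u) h \<le> 5 * L + 4"
    by (simp add: t_def v_def)
qed

lemma confined_bounds:
  fixes L :: real
  assumes "legal h" "u \<in> directions" "L \<ge> 0" "confined (shift u) L h"
  shows "reach u h + reach (- u) h - \<bar>proj u (pos h)\<bar> \<le> 4 * L + 3"
    and "turns u h + turns (- u) h \<le> 5 * L + 4"
proof -
  have S: "\<bar>total (shift u) h\<bar> \<le> L" "\<bar>total (shift (- u)) h\<bar> \<le> L"
    using confined_total[OF assms(4,3)] by (simp_all add: total_shift_uminus)
  have "near_corner u L h \<or> near_corner (- u) L h" by (rule confined_near_corner[OF assms])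
  then have "reach u h + reach (- u) h - \<bar>proj u (pos h)\<bar> \<le> 4 * L + 3
      \<and> turns u h + turns (- u) h \<le> 5 * L + 4"
  proof
    assume "near_corner u L h"
    then show ?thesis using near_corner_bounds[OF assms(1,2) _ S(1)] by blast
  next
    assume "near_corner (- u) L h"
    then show ?thesis
      using near_corner_bounds[OF assms(1) _ _ S(2)] assms(2) by (simp add: add.commute)
  qed
  then show "reach u h + reach (- u) h - \<bar>proj u (pos h)\<bar> \<le> 4 * L + 3"
    and "turns u h + turns (- u) h \<le> 5 * L + 4" by blast+
qed

text \<open>The half-perimeter \<open>N\<close> exceeds the norm by at most 8 L + 6 and differs from
  3/7 of the time by at most L + 5/7 + 6/7 (10 L + 8); the total is rounded up.\<close>

lemma confined_speed:
  fixes L :: real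
  assumes "legal h" "L \<ge> 0" "confined (shift (1, 0)) L h" "confined (shift (0, 1)) L h" "confined clock L h"
  shows "\<bar>l1_norm (pos h) - 3 / 7 * length h\<bar> \<le> 18 * L + 14"
proof -
  have dirs: "(1, 0) \<in> directions" "(0, 1) \<in> directions" by (simp_all add: directions_def)
  have sum: "(\<Sum>u\<in>directions. f u) = f (1, 0) + f (- 1, 0) + f (0, 1) + f (0, - 1)" for f :: "site \<Rightarrow> int"
    by (simp add: directions_def)
  note x = confined_bounds[OF assms(1) dirs(1) assms(2,3)] and y = confined_bounds[OF assms(1) dirs(2) assms(2,4)]
  have le: "\<bar>proj u (pos h)\<bar> \<le> reach u h + reach (- u) h" if "u \<in> directions" for u
    using proj_le_reach[OF legal_directions[OF assms(1)] that pos_visited]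
      proj_le_reach[OF legal_directions[OF assms(1)] _ pos_visited, of "- u"] that reach_nonneg[of u h] reach_nonneg[of "- u" h]
    by simp
  define N T where "N = real_of_int (\<Sum>u\<in>directions. reach u h)" and "T = real_of_int (\<Sum>u\<in>directions. turns u h)"
  have norm: "l1_norm (pos h) = \<bar>proj (1, 0) (pos h)\<bar> + \<bar>proj (0, 1) (pos h)\<bar>"
    by (simp add: l1_norm_def proj_def)
  have "N - l1_norm (pos h) \<le> 8 * L + 6" "l1_norm (pos h) \<le> N"
    using x(1) y(1) le[OF dirs(1)] le[OF dirs(2)] by (simp_all add: N_def norm sum)
  moreover have "T \<le> 10 * L + 8" "0 \<le> T"
    using x(2) y(2) turns_bounds(1)[of _ h] by (simp_all add: T_def sum)
  \<comment> \<open>The 5/7 covers the initial 4/7 and the run correction 1/7.\<close>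
  moreover have "\<bar>N - 3 / 7 * length h\<bar> \<le> L + 5 / 7 + 6 / 7 * T"
    using total_clock[OF assms(1)] confined_total[OF assms(5,2)] \<open>0 \<le> T\<close>
    unfolding N_def[symmetric] T_def[symmetric] by (auto simp: abs_le_iff split: if_splits)
  ultimately show ?thesis using assms(2) by linarith
qed


section \<open>The law of the walk\<close>

lemma card_free: "finite (free h)" "legal h \<Longrightarrow> card (free h) > 0"
proof -
  show fin: "finite (free h)" by (simp add: free_def)
  assume "legal h"
  then have "free h \<noteq> {}" by (cases rule: free_cases) (auto simp: directions_def)
  then show "card (free h) > 0" using fin by (simp add: card_gt_0_iff)
qed

text \<open>The probability that the uniform rule prescribes for the history \<open>h\<close>;
  \<open>prob_path\<close> identifies it with that of the process.\<close>

primrec weight :: "site list \<Rightarrow> real" where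
  "weight [] = 1"
| "weight (e # h) = (if e \<in> free h then weight h / card (free h) else 0)"

definition paths :: "nat \<Rightarrow> site list set" where
  "paths t = {h. set h \<subseteq> directions \<and> length h = t}"

lemma finite_paths [simp]: "finite (paths t)"
  unfolding paths_def by (rule finite_lists_length_eq) simp

lemma weight_nonneg: "weight h \<ge> 0"
  by (induction h) simp_all

lemma weight_eq_0: "\<not> legal h \<Longrightarrow> weight h = 0"
  by (induction h) auto

text \<open>The tower property: average over the latest step first, given the steps before
  it.\<close>

lemma sum_paths_Suc:
  "(\<Sum>h\<in>paths (Suc t). weight h * F h) = (\<Sum>h\<in>paths t. weight h * ((\<Sum>e\<in>free h. F (e # h)) / card (free h)))"
proof -
  have "paths (Suc t) = (\<lambda>(h, e). e # h) ` (paths t \<times> directions)"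
  proof (intro equalityI subsetI)
    fix h assume "h \<in> paths (Suc t)"
    then show "h \<in> (\<lambda>(h, e). e # h) ` (paths t \<times> directions)"
      by (cases h) (auto simp: paths_def intro!: image_eqI[where x = "(tl h, hd h)"])
  qed (auto simp: paths_def)
  moreover have "inj_on (\<lambda>(h, e). e # h) (paths t \<times> directions)" by (auto simp: inj_on_def)
  ultimately have "(\<Sum>h\<in>paths (Suc t). weight h * F h) =
      (\<Sum>(h, e)\<in>paths t \<times> directions. weight (e # h) * F (e # h))"
    by (simp add: sum.reindex split_def)
  also have "\<dots> = (\<Sum>h\<in>paths t. \<Sum>e\<in>directions. weight (e # h) * F (e # h))"
    by (simp add: sum.cartesian_product)
  also have "\<dots> = (\<Sum>h\<in>paths t. weight h * ((\<Sum>e\<in>free h. F (e # h)) / card (free h)))"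
  proof (rule sum.cong)
    fix h
    have "(\<Sum>e\<in>directions. weight (e # h) * F (e # h)) = (\<Sum>e\<in>free h. weight (e # h) * F (e # h))"
      by (rule sum.mono_neutral_right) (auto simp: free_def)
    then show "(\<Sum>e\<in>directions. weight (e # h) * F (e # h)) = weight h * ((\<Sum>e\<in>free h. F (e # h)) / card (free h))"
      by (simp add: sum_distrib_left sum_divide_distrib)
  qed simp
  finally show ?thesis .
qed

lemma weight_mono:
  assumes "\<And>h. legal h \<Longrightarrow> F h \<le> G h"
  shows "(\<Sum>h\<in>A. weight h * F h) \<le> (\<Sum>h\<in>A. weight h * G h)"
  by (intro sum_mono) (metis assms weight_eq_0 weight_nonneg mult_left_mono mult_zero_left order_refl)

lemma sum_weight: "(\<Sum>h\<in>paths t. weight h) = 1"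
proof (induction t)
  case 0
  have "paths 0 = {[]}" by (auto simp: paths_def)
  then show ?case by simp
next
  case (Suc t)
  have "(\<Sum>h\<in>paths (Suc t). weight h * 1) = (\<Sum>h\<in>paths t. weight h * (real (card (free h)) / card (free h)))"
    unfolding sum_paths_Suc by simp
  also have "\<dots> = (\<Sum>h\<in>paths t. weight h)"
  proof (rule sum.cong)
    fix h
    show "weight h * (real (card (free h)) / card (free h)) = weight h"
      \<comment> \<open>A legal path has an allowed direction, so the quotient is 1; an illegal one
        has weight 0.\<close>
      using card_free(2)[of h] weight_eq_0[of h] by (cases "legal h") auto
  qed simp
  finally show ?case using Suc by simp
qed

text \<open>Stopping at the first exit from \<open>{- L..L}\<close> turns Chebyshev's inequality at the final time into a
  maximal inequality.\<close>

primrec stopped :: "(site list \<Rightarrow> site \<Rightarrow> real) \<Rightarrow> real \<Rightarrow> site list \<Rightarrow> real" where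
  "stopped inc L [] = 0"
| "stopped inc L (e # h) = stopped inc L h + (if \<bar>stopped inc L h\<bar> \<le> L then inc h e else 0)"

text \<open>The stopped process freezes once it is outside, so being inside now means it never
  left.\<close>

lemma stopped_confined:
  assumes "\<bar>stopped inc L h\<bar> \<le> L"
  shows "confined inc L h \<and> stopped inc L h = total inc h"
  using assms by (induction h) (auto split: if_splits)

text \<open>Martingale increments are orthogonal, so each step adds at most \<open>c\<^sup>2\<close>
  to the second moment.\<close>

lemma second_moment:
  assumes "\<And>h. legal h \<Longrightarrow> (\<Sum>e\<in>free h. inc h e) = 0"
    and "\<And>h e. legal h \<Longrightarrow> e \<in> free h \<Longrightarrow> \<bar>inc h e\<bar> \<le> c"
  shows "(\<Sum>h\<in>paths t. weight h * (stopped inc L h)\<^sup>2) \<le> c\<^sup>2 * t"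
proof (induction t)
  case 0
  have "paths 0 = {[]}" by (auto simp: paths_def)
  then show ?case by simp
next
  case (Suc t)
  have step: "(\<Sum>e\<in>free h. (stopped inc L (e # h))\<^sup>2) / card (free h) \<le> (stopped inc L h)\<^sup>2 + c\<^sup>2"
    if h: "legal h" for h
  proof -
    define s j where "s = stopped inc L h" and "j = (\<lambda>e. if \<bar>s\<bar> \<le> L then inc h e else 0)"
    have j0: "(\<Sum>e\<in>free h. j e) = 0" using assms(1)[OF h] by (cases "\<bar>s\<bar> \<le> L") (simp_all add: j_def)
    have jc: "(j e)\<^sup>2 \<le> c\<^sup>2" if "e \<in> free h" for e
      using assms(2)[OF h that] by (auto simp: j_def simp flip: abs_le_square_iff)
    have "(\<Sum>e\<in>free h. (stopped inc L (e # h))\<^sup>2) = (\<Sum>e\<in>free h. s\<^sup>2 + 2 * s * j e + (j e)\<^sup>2)"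
      by (simp add: s_def j_def power2_sum algebra_simps)
    \<comment> \<open>The cross term vanishes because \<open>j\<close> sums to zero.\<close>
    also have "\<dots> = card (free h) * s\<^sup>2 + (\<Sum>e\<in>free h. (j e)\<^sup>2)"
      by (simp add: sum.distrib j0 flip: sum_distrib_left)
    also have "\<dots> \<le> card (free h) * s\<^sup>2 + card (free h) * c\<^sup>2"
      using sum_mono[of "free h" "\<lambda>e. (j e)\<^sup>2" "\<lambda>_. c\<^sup>2"] jc by simp
    finally show ?thesis
      using card_free(2)[OF h] by (simp add: s_def divide_le_eq algebra_simps)
  qed
  have "(\<Sum>h\<in>paths (Suc t). weight h * (stopped inc L h)\<^sup>2) \<le>
      (\<Sum>h\<in>paths t. weight h * ((stopped inc L h)\<^sup>2 + c\<^sup>2))"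
    unfolding sum_paths_Suc by (rule weight_mono[OF step])
  also have "\<dots> = (\<Sum>h\<in>paths t. weight h * (stopped inc L h)\<^sup>2) + c\<^sup>2"
    by (simp add: distrib_left sum.distrib sum_weight flip: sum_distrib_right)
  also have "\<dots> \<le> c\<^sup>2 * Suc t" using Suc by (simp add: algebra_simps)
  finally show ?case .
qed

lemma weight_not_confined:
  assumes "\<And>h. legal h \<Longrightarrow> (\<Sum>e\<in>free h. inc h e) = 0"
    and "\<And>h e. legal h \<Longrightarrow> e \<in> free h \<Longrightarrow> \<bar>inc h e\<bar> \<le> c"
    and "L > 0"
  shows "(\<Sum>h\<in>paths t. weight h * of_bool (\<not> confined inc L h)) \<le> c\<^sup>2 * t / L\<^sup>2"
proof -
  have "of_bool (\<not> confined inc L h) \<le> (stopped inc L h)\<^sup>2 / L\<^sup>2" for h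
  proof (cases "confined inc L h")
    case False
    then have "\<bar>stopped inc L h\<bar> > L" using stopped_confined[of inc L h] by linarith
    then have "L\<^sup>2 \<le> (stopped inc L h)\<^sup>2" using assms(3) by (simp flip: abs_le_square_iff)
    then show ?thesis using False assms(3) by simp
  qed simp
  then have "(\<Sum>h\<in>paths t. weight h * of_bool (\<not> confined inc L h)) \<le>
      (\<Sum>h\<in>paths t. weight h * ((stopped inc L h)\<^sup>2 / L\<^sup>2))"
    by (rule weight_mono)
  also have "\<dots> = (\<Sum>h\<in>paths t. weight h * (stopped inc L h)\<^sup>2) / L\<^sup>2"
    by (simp add: sum_divide_distrib)
  also have "\<dots> \<le> c\<^sup>2 * t / L\<^sup>2"
    using second_moment[OF assms(1,2)] by (simp add: divide_right_mono)
  finally show ?thesis .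
qed

text \<open>A union bound over three martingales with increments at most 2, which gives 3 * 4 =
  12.\<close>

lemma weight_slow:
  assumes "L > 0"
  shows "(\<Sum>h\<in>paths t. weight h * of_bool (\<not> (legal h \<and> \<bar>l1_norm (pos h) - 3 / 7 * t\<bar> \<le> 18 * L + 14)))
    \<le> 12 * real t / L\<^sup>2"
proof -
  let ?bad = "\<lambda>inc. (\<Sum>h\<in>paths t. weight h * of_bool (\<not> confined inc L h))"
  have dirs: "(1, 0) \<in> directions" "(0, 1) \<in> directions" by (simp_all add: directions_def)
  have bad: "?bad (shift (1, 0)) \<le> 2\<^sup>2 * real t / L\<^sup>2" "?bad (shift (0, 1)) \<le> 2\<^sup>2 * real t / L\<^sup>2"
    "?bad clock \<le> 2\<^sup>2 * real t / L\<^sup>2"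
    by (intro weight_not_confined shift_clock_sum shift_bound clock_bound dirs assms; assumption)+
  have "(\<Sum>h\<in>paths t. weight h * of_bool (\<not> (legal h \<and> \<bar>l1_norm (pos h) - 3 / 7 * t\<bar> \<le> 18 * L + 14)))
    \<le> (\<Sum>h\<in>paths t. weight h * (of_bool (\<not> confined (shift (1, 0)) L h) +
        of_bool (\<not> confined (shift (0, 1)) L h) + of_bool (\<not> confined clock L h)))"
  proof (rule sum_mono)
    fix h assume "h \<in> paths t"
    then have len: "length h = t" by (simp add: paths_def)
    show "weight h * of_bool (\<not> (legal h \<and> \<bar>l1_norm (pos h) - 3 / 7 * t\<bar> \<le> 18 * L + 14))
      \<le> weight h * (of_bool (\<not> confined (shift (1, 0)) L h) +
        of_bool (\<not> confined (shift (0, 1)) L h) + of_bool (\<not> confined clock L h))"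
    proof (cases "legal h")
      case True
      then show ?thesis
        using confined_speed[OF True _, of L] assms len
        by (intro mult_left_mono weight_nonneg) auto
    qed (simp add: weight_eq_0)
  qed
  also have "\<dots> = ?bad (shift (1, 0)) + ?bad (shift (0, 1)) + ?bad clock"
    by (simp add: distrib_left sum.distrib)
  also have "\<dots> \<le> 12 * real t / L\<^sup>2" using bad by simp
  finally show ?thesis .
qed


section \<open>From weighted histories to the process\<close>

definition path :: "site list \<Rightarrow> nat \<Rightarrow> site" where
  "path h s = pos (drop (length h - s) h)"

text \<open>Recovers the list from its trajectory, which makes the events of distinct histories of
  equal length disjoint.\<close>

primrec steps :: "(nat \<Rightarrow> site) \<Rightarrow> nat \<Rightarrow> site list" where
  "steps x 0 = []"
| "steps x (Suc t) = (x (Suc t) - x t) # steps x t"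

lemma path_length: "path h (length h) = pos h"
  by (simp add: path_def)

lemma path_Cons:
  "s \<le> length h \<Longrightarrow> path (e # h) s = path h s" "path (e # h) (Suc (length h)) = e + pos h"
  by (simp_all add: path_def Suc_diff_le)

lemma path_image: "path h ` {0..length h} = visited h"
proof (induction h)
  case (Cons e h)
  have "path (e # h) ` {0..length h} = path h ` {0..length h}"
    by (intro image_cong) (simp_all add: path_Cons)
  then show ?case using Cons by (simp add: atLeastAtMostSuc_conv path_Cons)
qed (simp add: path_def)

lemma allowed_directions_path: "allowed_directions (path h) (length h) = free h"
  unfolding allowed_directions_def free_def path_image path_length ..

text \<open>Puts the event in the form of a next step together with a history, as in the locale
  assumption \<open>step\<close>.\<close>

lemma agrees_path_Cons:
  "(\<forall>s\<le>length (e # h). x s = path (e # h) s) \<longleftrightarrow>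
    x (Suc (length h)) = x (length h) + e \<and> (\<forall>s\<le>length h. x s = path h s)"
proof -
  have "(\<forall>s\<le>length (e # h). x s = path (e # h) s) \<longleftrightarrow>
      x (Suc (length h)) = e + pos h \<and> (\<forall>s\<le>length h. x s = path (e # h) s)"
    by (auto simp: le_Suc_eq path_Cons)
  also have "\<dots> \<longleftrightarrow> x (Suc (length h)) = e + pos h \<and> (\<forall>s\<le>length h. x s = path h s)"
    by (simp add: path_Cons)
  also have "\<dots> \<longleftrightarrow> x (Suc (length h)) = x (length h) + e \<and> (\<forall>s\<le>length h. x s = path h s)"
    using path_length[of h] by (auto simp: add.commute)
  finally show ?thesis .
qed

lemma agrees_path_imp:
  assumes "\<forall>s\<le>length h. x s = path h s"
  shows "steps x (length h) = h" "x (length h) = pos h"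
proof -
  show "x (length h) = pos h" using assms by (simp add: path_length)
  show "steps x (length h) = h"
    using assms
  proof (induction h)
    case (Cons e h)
    then show ?case unfolding agrees_path_Cons by simp
  qed simp
qed

context prudent_walk
begin

lemma sets_agrees: "{\<omega> \<in> space M. \<forall>s\<le>t. \<gamma> s \<omega> = x s} \<in> sets M"
proof -
  note measurable_walk [measurable]
  show ?thesis by measurable
qed

lemma prob_path:
  assumes "set h \<subseteq> directions"
  shows "\<P>(\<omega> in M. \<forall>s\<le>length h. \<gamma> s \<omega> = path h s) = weight h"
  using assms
proof (induction h)
  case Nil
  have "AE \<omega> in M. \<forall>s\<le>length []. \<gamma> s \<omega> = path [] s"
    using start by eventually_elim (simp add: path_def flip: zero_prod_def)
  then have "\<P>(\<omega> in M. \<forall>s\<le>length []. \<gamma> s \<omega> = path [] s) = 1"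
    by (simp only: prob_Collect_eq_1[OF sets_agrees])
  then show ?case by simp
next
  case (Cons e h)
  let ?Q = "\<lambda>\<omega>. \<forall>s\<le>length h. \<gamma> s \<omega> = path h s"
  let ?P = "\<lambda>\<omega>. \<gamma> (Suc (length h)) \<omega> = \<gamma> (length h) \<omega> + e"
  have IH: "\<P>(\<omega> in M. ?Q \<omega>) = weight h" using Cons.IH Cons.prems by simp
  have eq: "\<P>(\<omega> in M. \<forall>s\<le>length (e # h). \<gamma> s \<omega> = path (e # h) s) = \<P>(\<omega> in M. ?P \<omega> \<and> ?Q \<omega>)"
    unfolding agrees_path_Cons ..
  show ?case
  proof (cases "weight h = 0")
    \<comment> \<open>The assumption \<open>step\<close> covers only histories of positive
      probability; an extension of a null history is null.\<close>
    case True
    have "\<P>(\<omega> in M. ?P \<omega> \<and> ?Q \<omega>) \<le> \<P>(\<omega> in M. ?Q \<omega>)"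
      by (rule finite_measure_mono[OF _ sets_agrees]) blast
    then have "\<P>(\<omega> in M. ?P \<omega> \<and> ?Q \<omega>) = 0"
      unfolding IH True by (intro antisym measure_nonneg)
    then show ?thesis using True unfolding eq by simp
  next
    case False
    then have pos: "\<P>(\<omega> in M. ?Q \<omega>) > 0" using IH weight_nonneg[of h] by simp
    have "\<P>(\<omega> in M. ?P \<omega> \<bar> ?Q \<omega>) = (if e \<in> free h then 1 / real (card (free h)) else 0)"
      using step[OF pos] Cons.prems by (simp add: allowed_directions_path)
    then have "\<P>(\<omega> in M. ?P \<omega> \<and> ?Q \<omega>) = (if e \<in> free h then 1 / real (card (free h)) else 0) * weight h"
      unfolding cond_prob_def IH nonzero_divide_eq_eq[OF False] .
    then show ?thesis unfolding eq by simp
  qed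
qed

text \<open>Good histories have disjoint events of total probability at least
  \<open>1 - 12 * real t / L\<^sup>2\<close>, and the event in question lies in the complement of
  their union.\<close>

lemma prob_slow:
  fixes L \<epsilon> :: real
  assumes "L > 0" "18 * L + 14 \<le> \<epsilon> * t"
  shows "\<P>(\<omega> in M. \<bar>1 / real t * l1_norm (\<gamma> t \<omega>) - 3 / 7\<bar> > \<epsilon>) \<le> 12 * real t / L\<^sup>2"
proof -
  define good where "good h \<longleftrightarrow> legal h \<and> \<bar>l1_norm (pos h) - 3 / 7 * t\<bar> \<le> 18 * L + 14" for h
  define E where "E h = {\<omega> \<in> space M. \<forall>s\<le>length h. \<gamma> s \<omega> = path h s}" for h
  define G where "G = {h \<in> paths t. good h}"
  have fin: "finite G" by (simp add: G_def)
  have E_sets: "E h \<in> sets M" for h unfolding E_def by (rule sets_agrees)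
  have "prob (\<Union>h\<in>G. E h) = (\<Sum>h\<in>G. prob (E h))"
  proof (rule finite_measure_finite_Union[OF fin])
    show "disjoint_family_on E G"
      unfolding disjoint_family_on_def
    proof (intro ballI impI)
      fix g h assume "g \<in> G" "h \<in> G" "g \<noteq> h"
      then have "length g = length h" by (simp add: G_def paths_def)
      then show "E g \<inter> E h = {}"
        using agrees_path_imp(1)[of g] agrees_path_imp(1)[of h] \<open>g \<noteq> h\<close> unfolding E_def by force
    qed
  qed (use E_sets in auto)
  also have "\<dots> = (\<Sum>h\<in>G. weight h)"
    unfolding E_def by (intro sum.cong refl prob_path) (simp add: G_def paths_def)
  also have "\<dots> = (\<Sum>h\<in>paths t. weight h * of_bool (good h))"
    unfolding G_def by (simp add: sum.inter_filter of_bool_def if_distrib cong: if_cong)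
  also have "\<dots> = 1 - (\<Sum>h\<in>paths t. weight h * of_bool (\<not> good h))"
    by (simp add: of_bool_not_iff algebra_simps sum_subtractf sum_weight)
  also have "\<dots> \<ge> 1 - 12 * real t / L\<^sup>2"
    using weight_slow[OF assms(1), of t] unfolding good_def by simp
  finally have G: "prob (\<Union>h\<in>G. E h) \<ge> 1 - 12 * real t / L\<^sup>2" .
  \<comment> \<open>At time 0 the second hypothesis would read 18 L + 14 \<le> 0.\<close>
  have "t > 0" using assms by (cases t) auto
  have "\<bar>1 / real t * l1_norm (\<gamma> t \<omega>) - 3 / 7\<bar> \<le> \<epsilon>" if "\<omega> \<in> E h" "h \<in> G" for \<omega> h
  proof -
    have "length h = t" "good h" using that(2) by (simp_all add: G_def paths_def)
    then have "\<bar>l1_norm (\<gamma> t \<omega>) - 3 / 7 * t\<bar> \<le> \<epsilon> * t"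
      using agrees_path_imp(2)[of h "\<lambda>s. \<gamma> s \<omega>"] that(1) assms(2) by (auto simp: E_def good_def)
    moreover have "1 / real t * l1_norm (\<gamma> t \<omega>) - 3 / 7 = (l1_norm (\<gamma> t \<omega>) - 3 / 7 * t) / t"
      using \<open>t > 0\<close> by (simp add: diff_divide_distrib)
    ultimately show ?thesis using \<open>t > 0\<close> by (simp only: abs_divide) (simp add: divide_le_eq)
  qed
  then have "{\<omega> \<in> space M. \<bar>1 / real t * l1_norm (\<gamma> t \<omega>) - 3 / 7\<bar> > \<epsilon>} \<subseteq> space M - (\<Union>h\<in>G. E h)"
    by (force simp: not_less[symmetric])
  then have "\<P>(\<omega> in M. \<bar>1 / real t * l1_norm (\<gamma> t \<omega>) - 3 / 7\<bar> > \<epsilon>) \<le> prob (space M - (\<Union>h\<in>G. E h))"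
    using E_sets fin by (intro finite_measure_mono) auto
  also have "\<dots> = 1 - prob (\<Union>h\<in>G. E h)"
    using E_sets fin by (intro prob_compl) auto
  finally show ?thesis using G by simp
qed

end

theorem mainTheorem2:
  fixes M :: "'a measure" and \<gamma> :: "nat \<Rightarrow> 'a \<Rightarrow> site" and \<epsilon> :: real
  assumes "prudent_walk M \<gamma>" and "\<epsilon> > 0"
  shows "(\<lambda>t. \<P>(\<omega> in M. \<bar>1 / real t * l1_norm (\<gamma> t \<omega>) - 3 / 7\<bar> > \<epsilon>)) \<longlonglongrightarrow> 0"
proof (rule tendsto_sandwich[OF _ _ tendsto_const])
  show "\<forall>\<^sub>F t in sequentially. \<P>(\<omega> in M. \<bar>1 / real t * l1_norm (\<gamma> t \<omega>) - 3 / 7\<bar> > \<epsilon>)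
      \<le> 12 * 36\<^sup>2 / \<epsilon>\<^sup>2 * inverse (real t)"
    using filterlim_real_sequentially[unfolded filterlim_at_top, rule_format, of "28 / \<epsilon>"]
  proof eventually_elim
    case (elim t)
    moreover have "28 / \<epsilon> > 0" using assms(2) by simp
    ultimately have "t > 0" by (metis less_le_trans of_nat_0_less_iff)
    \<comment> \<open>This makes 18 L half of \<epsilon> t; the other half is at least 14 because t
      \<ge> 28 / \<epsilon>.\<close>
    define L where "L = \<epsilon> * t / 36"
    have "L > 0" "18 * L + 14 \<le> \<epsilon> * t"
      using \<open>t > 0\<close> elim assms(2) by (simp_all add: L_def field_simps)
    from prudent_walk.prob_slow[OF assms(1) this]
    show ?case using \<open>t > 0\<close> assms(2) by (simp add: L_def field_simps power2_eq_square)
  qed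
  show "(\<lambda>t. 12 * 36\<^sup>2 / \<epsilon>\<^sup>2 * inverse (real t)) \<longlonglongrightarrow> 0"
    by (intro tendsto_mult_right_zero lim_inverse_n)
qed auto

end
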